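(* $\mathrm{sat}^*(n,\mathcal N)=\Theta(n)$; that is, there are constants $c_1,c_2>0$ such that $c_1 n\le \mathrm{sat}^*(n,\mathcal N)\le c_2 n$ for all sufficiently large $n$.
   Context: The poset $\mathcal N$ has four elements $a,b,c,d$ with $a<c$, $b<c$, $b<d$ and no other comparabilities. A family $\mathcal Q$ of sets (ordered by inclusion) contains an induced copy of $\mathcal N$ if there are distinct sets in $\mathcal Q$ whose inclusion relations are exactly those of $a,b,c,d$ above. A family $\mathcal F$ of subsets of $[n]=\{1,\dots,n\}$ is $\mathcal N$-saturated if $\mathcal F$ contains no induced copy of $\mathcal N$, but for every $S\subseteq[n]$ with $S\notin\mathcal F$, the family $\mathcal F\cup\{S\}$ contains an induced copy of $\mathcal N$. The induced saturation number $\mathrm{sat}^*(n,\mathcal N)$ is the minimum size of an $\mathcal N$-saturated family of subsets of $[n]$. *)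

theory Defs
  imports Complex_Main
begin

definition incomparable :: "'a set \<Rightarrow> 'a set \<Rightarrow> bool" where
  "incomparable X Y \<longleftrightarrow> \<not> X \<subseteq> Y \<and> \<not> Y \<subseteq> X"

definition contains_induced_N :: "'a set set \<Rightarrow> bool" where
  "contains_induced_N Q \<longleftrightarrow>
     (\<exists>A B C D. A \<in> Q \<and> B \<in> Q \<and> C \<in> Q \<and> D \<in> Q \<and>
        A \<noteq> B \<and> A \<noteq> C \<and> A \<noteq> D \<and> B \<noteq> C \<and> B \<noteq> D \<and> C \<noteq> D \<and>
        A \<subset> C \<and> B \<subset> C \<and> B \<subset> D \<and>
        incomparable A B \<and> incomparable A D \<and> incomparable C D)"

definition N_saturated :: "nat \<Rightarrow> nat set set \<Rightarrow> bool" where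
  "N_saturated n F \<longleftrightarrow>
     F \<subseteq> Pow {1..n} \<and> \<not> contains_induced_N F \<and>
     (\<forall>S. S \<subseteq> {1..n} \<and> S \<notin> F \<longrightarrow> contains_induced_N (insert S F))"

definition sat_star_N :: "nat \<Rightarrow> nat" where
  "sat_star_N n = (LEAST k. \<exists>F. N_saturated n F \<and> card F = k)"

end

theory Submission
  imports Defs
begin

text \<open>
  The upper bound comes from the family of all initial segments and all singletons.

  For the lower bound, let \<open>X \<subset> Y\<close> be neighbouring members of a saturated family \<open>F\<close>. Let \<open>D\<close> consist of
  the members below \<open>Y\<close> but not below \<open>X\<close>, and \<open>E\<close> of the members above \<open>X\<close> but not above \<open>Y\<close>.
  Then \<open>card (Y - X) \<le> card D + card E\<close>: apart from \<open>Y \<in> D\<close> and \<open>X \<in> E\<close>, at most one of \<open>D\<close>, \<open>E\<close> has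
  further members, since otherwise the union of \<open>X\<close> and the rest of \<open>D\<close> could be added to \<open>F\<close>
  (from above it looks like \<open>X\<close>, from below like \<open>Y\<close>). If \<open>D\<close> has none, then for each \<open>x \<in> Y - X\<close>
  the set \<open>Y - {x}\<close> cannot be distinguished from \<open>Y\<close> unless some \<open>Z \<in> E\<close> satisfies \<open>Z \<inter> Y = Y - {x}\<close>;
  these \<open>Z\<close> are distinct for distinct \<open>x\<close>. The other case is dual. Summing along a chain
  from the empty set to \<open>{1..n}\<close>, every member of \<open>F\<close> is counted at most twice, so \<open>n \<le> 2 * card F\<close>.
\<close>

section \<open>Induced copies of \<open>N\<close>\<close>

text \<open>Three non-inclusions suffice: \<open>A \<subseteq> B\<close> or
  \<open>C \<subseteq> D\<close> would give \<open>A \<subseteq> D\<close>, and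
  \<open>D \<subseteq> A\<close> would give \<open>D \<subseteq> C\<close>.\<close>

definition is_N :: "'a set \<Rightarrow> 'a set \<Rightarrow> 'a set \<Rightarrow> 'a set \<Rightarrow> bool" where
  "is_N A B C D \<longleftrightarrow> A \<subseteq> C \<and> B \<subseteq> C \<and> B \<subseteq> D \<and> \<not> A \<subseteq> D \<and> \<not> B \<subseteq> A \<and> \<not> D \<subseteq> C"

lemma contains_induced_N_iff:
  "contains_induced_N Q \<longleftrightarrow> (\<exists>A\<in>Q. \<exists>B\<in>Q. \<exists>C\<in>Q. \<exists>D\<in>Q. is_N A B C D)"
proof
  assume "contains_induced_N Q"
  then show "\<exists>A\<in>Q. \<exists>B\<in>Q. \<exists>C\<in>Q. \<exists>D\<in>Q. is_N A B C D"
    unfolding contains_induced_N_def is_N_def incomparable_def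
    by (elim exE) (meson psubset_imp_subset)
next
  assume "\<exists>A\<in>Q. \<exists>B\<in>Q. \<exists>C\<in>Q. \<exists>D\<in>Q. is_N A B C D"
  then obtain A B C D where Q: "A \<in> Q" "B \<in> Q" "C \<in> Q" "D \<in> Q" and N: "is_N A B C D"
    by blast
  have "A \<noteq> B \<and> A \<noteq> C \<and> A \<noteq> D \<and> B \<noteq> C \<and> B \<noteq> D \<and> C \<noteq> D"
    using N unfolding is_N_def by auto
  moreover have "incomparable A B \<and> incomparable A D \<and> incomparable C D"
    using N unfolding is_N_def incomparable_def by blast
  ultimately show "contains_induced_N Q"
    using Q N unfolding contains_induced_N_def is_N_def psubset_eq by blast
qed

lemma insert_creates_N_cases:
  assumes free: "\<not> contains_induced_N F" and ins: "contains_induced_N (insert S F)"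
  obtains
    (A) B C D where "B \<in> F" "C \<in> F" "D \<in> F" "is_N S B C D"
  | (B) A C D where "A \<in> F" "C \<in> F" "D \<in> F" "is_N A S C D"
  | (C) A B D where "A \<in> F" "B \<in> F" "D \<in> F" "is_N A B S D"
  | (D) A B C where "A \<in> F" "B \<in> F" "C \<in> F" "is_N A B C S"
proof -
  obtain A B C D where
    Q: "A \<in> insert S F" "B \<in> insert S F" "C \<in> insert S F" "D \<in> insert S F" and N: "is_N A B C D"
    using ins unfolding contains_induced_N_iff by blast
  have ne: "A \<noteq> B" "A \<noteq> C" "A \<noteq> D" "B \<noteq> C" "B \<noteq> D" "C \<noteq> D"
    using N unfolding is_N_def by auto
  consider "A = S" | "B = S" | "C = S" | "D = S" | "A \<in> F" "B \<in> F" "C \<in> F" "D \<in> F"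
    using Q by blast
  then show thesis
  proof cases
    case 1
    then show thesis using Q N ne by (intro that(1)[of B C D]) auto
  next
    case 2
    then show thesis using Q N ne by (intro that(2)[of A C D]) auto
  next
    case 3
    then show thesis using Q N ne by (intro that(3)[of A B D]) auto
  next
    case 4
    then show thesis using Q N ne by (intro that(4)[of A B C]) auto
  next
    case 5
    then show thesis using N free unfolding contains_induced_N_iff by blast
  qed
qed

section \<open>The lower bound\<close>

context
  fixes n :: nat and F :: "nat set set"
  assumes sat: "N_saturated n F"
begin

lemma saturated_free: "\<not> contains_induced_N F"
  using sat unfolding N_saturated_def by blast

lemma saturated_subset: "Z \<in> F \<Longrightarrow> Z \<subseteq> {1..n}"
  using sat unfolding N_saturated_def by blast

lemma saturated_finite: "finite F"
  using sat unfolding N_saturated_def by (meson finite_Pow_iff finite_atLeastAtMost finite_subset)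

lemma saturated_no_N: "A \<in> F \<Longrightarrow> B \<in> F \<Longrightarrow> C \<in> F \<Longrightarrow> D \<in> F \<Longrightarrow> \<not> is_N A B C D"
  using saturated_free unfolding contains_induced_N_iff by blast

lemma saturated_blocked:
  assumes "S \<subseteq> {1..n}" "S \<notin> F"
  obtains
    (A) B C D where "B \<in> F" "C \<in> F" "D \<in> F" "is_N S B C D"
  | (B) A C D where "A \<in> F" "C \<in> F" "D \<in> F" "is_N A S C D"
  | (C) A B D where "A \<in> F" "B \<in> F" "D \<in> F" "is_N A B S D"
  | (D) A B C where "A \<in> F" "B \<in> F" "C \<in> F" "is_N A B C S"
proof -
  have "contains_induced_N (insert S F)"
    using sat assms unfolding N_saturated_def by blast
  with saturated_free show thesis
    by (rule insert_creates_N_cases) (fact that)+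
qed

lemma saturated_empty: "{} \<in> F"
proof (rule ccontr)
  assume "{} \<notin> F"
  then show False
    by (rule saturated_blocked[rotated]) (auto simp: is_N_def)
qed

lemma saturated_full: "{1..n} \<in> F"
proof (rule ccontr)
  assume "{1..n} \<notin> F"
  then show False
  proof (rule saturated_blocked[OF subset_refl])
  qed (use saturated_subset in \<open>unfold is_N_def, blast+\<close>)
qed

section \<open>Neighbouring members of a saturated family\<close>

lemma cover_one_sided:
  assumes X: "X \<in> F" and Y: "Y \<in> F" and XY: "X \<subset> Y"
    and cover: "\<And>Z. Z \<in> F \<Longrightarrow> X \<subseteq> Z \<Longrightarrow> Z \<subseteq> Y \<Longrightarrow> Z = X \<or> Z = Y"
  shows "(\<forall>Z\<in>F. Z \<subset> Y \<longrightarrow> Z \<subseteq> X) \<or> (\<forall>Z\<in>F. X \<subset> Z \<longrightarrow> Y \<subseteq> Z)"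
proof (rule ccontr)
  assume "\<not> ?thesis"
  then obtain B0 Z0 where B0: "B0 \<in> F" "B0 \<subset> Y" "\<not> B0 \<subseteq> X"
    and Z0: "Z0 \<in> F" "X \<subset> Z0" "\<not> Y \<subseteq> Z0" by blast
  define U where "U = \<Union>{B \<in> F. B \<subset> Y}"
  \<comment> \<open>In the remaining case \<open>cover\<close> gives
    \<open>\<not> Z \<subseteq> Y\<close> and \<open>\<not> X \<subseteq> B\<close>, so
    \<open>\<not> B \<subseteq> Z\<close> would make \<open>B\<close>, \<open>X\<close>,
    \<open>Y\<close>, \<open>Z\<close> an N.\<close>
  have cross: "B \<subseteq> Z" if "B \<in> F" "B \<subset> Y" "Z \<in> F" "X \<subset> Z" for B Z
  proof (cases "B \<subseteq> X \<or> Y \<subseteq> Z")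
    case False
    have "\<not> Z \<subseteq> Y" using cover[of Z] that False by blast
    moreover have "\<not> X \<subseteq> B" using cover[of B] that False by blast
    ultimately have "B \<subseteq> Z"
      using saturated_no_N[of B X Y Z] that X Y XY unfolding is_N_def by blast
    then show ?thesis .
  qed (use that in blast)
  have XU: "X \<subseteq> U" using X XY unfolding U_def by blast
  have UY: "U \<subseteq> Y" unfolding U_def by blast
  have UZ0: "U \<subseteq> Z0" using cross Z0 unfolding U_def by blast
  have "U \<noteq> X" using B0 unfolding U_def by blast
  moreover have "U \<noteq> Y" using UZ0 Z0 by blast
  ultimately have notin: "U \<notin> F" using cover XU UY by blast
  have below: "T \<subseteq> U \<longleftrightarrow> T \<subset> Y" if "T \<in> F" for T
    using that UY \<open>U \<noteq> Y\<close> unfolding U_def by blast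
  have above: "U \<subseteq> T \<longleftrightarrow> X \<subset> T" if "T \<in> F" for T
  proof
    assume "X \<subset> T"
    then show "U \<subseteq> T" using cross that unfolding U_def by blast
  qed (use XU \<open>U \<noteq> X\<close> in blast)
  have "U \<subseteq> {1..n}" using UY saturated_subset[OF Y] by blast
  \<comment> \<open>\<open>X\<close> replaces \<open>U\<close> in the lower roles, \<open>Y\<close>
    in the upper ones. The strict inclusions in \<open>above\<close> and \<open>below\<close> do no
    harm: a critical member equal to \<open>X\<close> or \<open>Y\<close> contradicts the copy, here
    for instance \<open>D = X\<close> would give \<open>B \<subseteq> U\<close>.\<close>
  then show False
    using notin
  proof (rule saturated_blocked)
    fix B C D assume F: "B \<in> F" "C \<in> F" "D \<in> F" and N: "is_N U B C D"
    have "is_N X B C D"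
      using N F above[of C] above[of D] XU below[of B] XY X unfolding is_N_def by blast
    with saturated_no_N X F show False by blast
  next
    fix A C D assume F: "A \<in> F" "C \<in> F" "D \<in> F" and N: "is_N A U C D"
    have "is_N A X C D"
      using N F above[of C] above[of D] above[of A] unfolding is_N_def by blast
    with saturated_no_N X F show False by blast
  next
    fix A B D assume F: "A \<in> F" "B \<in> F" "D \<in> F" and N: "is_N A B U D"
    have "is_N A B Y D"
      using N F below[of A] below[of B] below[of D] unfolding is_N_def by blast
    with saturated_no_N Y F show False by blast
  next
    fix A B C assume F: "A \<in> F" "B \<in> F" "C \<in> F" and N: "is_N A B C U"
    have "is_N A B C Y"
      using N F below[of A] below[of B] above[of C] XY unfolding is_N_def by blast
    with saturated_no_N Y F show False by blast
  qed
qed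

text \<open>Without such a \<open>Z\<close>, the set \<open>Y - {x}\<close> has the same members
  above it as \<open>Y\<close>, and by \<open>D\<close> the same ones below it except
  \<open>Y\<close>. Hence \<open>Y\<close> can replace it in any role of a copy. The condition
  \<open>ne\<close> puts it strictly between \<open>X\<close> and \<open>Y\<close>, so outside
  \<open>F\<close>.\<close>

lemma cover_witness_above:
  assumes X: "X \<in> F" and Y: "Y \<in> F"
    and cover: "\<And>Z. Z \<in> F \<Longrightarrow> X \<subseteq> Z \<Longrightarrow> Z \<subseteq> Y \<Longrightarrow> Z = X \<or> Z = Y"
    and D: "\<And>Z. Z \<in> F \<Longrightarrow> Z \<subset> Y \<Longrightarrow> Z \<subseteq> X"
    and x: "x \<in> Y - X" and ne: "Y - {x} \<noteq> X" and XY: "X \<subset> Y"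
  shows "\<exists>Z\<in>F. x \<notin> Z \<and> Y - {x} \<subseteq> Z"
proof (rule ccontr)
  assume none: "\<not> ?thesis"
  define S where "S = Y - {x}"
  have XS: "X \<subset> S" and SY: "S \<subset> Y" using x ne XY unfolding S_def by auto
  then have notin: "S \<notin> F" using cover by blast
  have below: "T \<subseteq> S \<longleftrightarrow> T \<subset> Y" if "T \<in> F" for T
    using that D XS SY by blast
  have above: "S \<subseteq> T \<longleftrightarrow> Y \<subseteq> T" if "T \<in> F" for T
    using that none unfolding S_def by blast
  have "S \<subseteq> {1..n}" using SY saturated_subset[OF Y] by blast
  then show False
    using notin
  proof (rule saturated_blocked)
    fix B C D assume F: "B \<in> F" "C \<in> F" "D \<in> F" and N: "is_N S B C D"
    have "is_N Y B C D"
      using N F above[of C] above[of D] below[of B] unfolding is_N_def by blast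
    with saturated_no_N Y F show False by blast
  next
    fix A C D assume F: "A \<in> F" "C \<in> F" "D \<in> F" and N: "is_N A S C D"
    have "is_N A Y C D"
      using N F above[of C] above[of D] above[of A] unfolding is_N_def by blast
    with saturated_no_N Y F show False by blast
  next
    fix A B D assume F: "A \<in> F" "B \<in> F" "D \<in> F" and N: "is_N A B S D"
    have "is_N A B Y D"
      using N F below[of A] below[of B] below[of D] above[of D] unfolding is_N_def by blast
    with saturated_no_N Y F show False by blast
  next
    fix A B C assume F: "A \<in> F" "B \<in> F" "C \<in> F" and N: "is_N A B C S"
    have "is_N A B C Y"
      using N F below[of A] below[of B] above[of C] above[of A] unfolding is_N_def by blast
    with saturated_no_N Y F show False by blast
  qed
qed

text \<open>Dual to \<open>cover_witness_above\<close>: here \<open>X\<close> replaces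
  \<open>insert x X\<close> in every role.\<close>

lemma cover_witness_below:
  assumes X: "X \<in> F" and Y: "Y \<in> F"
    and cover: "\<And>Z. Z \<in> F \<Longrightarrow> X \<subseteq> Z \<Longrightarrow> Z \<subseteq> Y \<Longrightarrow> Z = X \<or> Z = Y"
    and E: "\<And>Z. Z \<in> F \<Longrightarrow> X \<subset> Z \<Longrightarrow> Y \<subseteq> Z"
    and x: "x \<in> Y - X" and ne: "insert x X \<noteq> Y" and XY: "X \<subset> Y"
  shows "\<exists>Z\<in>F. x \<in> Z \<and> Z \<subseteq> insert x X"
proof (rule ccontr)
  assume none: "\<not> ?thesis"
  define S where "S = insert x X"
  have XS: "X \<subset> S" and SY: "S \<subset> Y" using x ne XY unfolding S_def by auto
  then have notin: "S \<notin> F" using cover by blast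
  have above: "S \<subseteq> T \<longleftrightarrow> X \<subset> T" if "T \<in> F" for T
    using that E XS SY by blast
  have below: "T \<subseteq> S \<longleftrightarrow> T \<subseteq> X" if "T \<in> F" for T
    using that none unfolding S_def by blast
  have "S \<subseteq> {1..n}" using SY saturated_subset[OF Y] by blast
  then show False
    using notin
  proof (rule saturated_blocked)
    fix B C D assume F: "B \<in> F" "C \<in> F" "D \<in> F" and N: "is_N S B C D"
    have "is_N X B C D"
      using N F above[of C] above[of D] below[of B] below[of D] unfolding is_N_def by blast
    with saturated_no_N X F show False by blast
  next
    fix A C D assume F: "A \<in> F" "C \<in> F" "D \<in> F" and N: "is_N A S C D"
    have "is_N A X C D"
      using N F above[of C] above[of D] above[of A] below[of A] unfolding is_N_def by blast
    with saturated_no_N X F show False by blast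
  next
    fix A B D assume F: "A \<in> F" "B \<in> F" "D \<in> F" and N: "is_N A B S D"
    have "is_N A B X D"
      using N F below[of A] below[of B] below[of D] unfolding is_N_def by blast
    with saturated_no_N X F show False by blast
  next
    fix A B C assume F: "A \<in> F" "B \<in> F" "C \<in> F" and N: "is_N A B C S"
    have "is_N A B C X"
      using N F below[of A] below[of B] above[of C] unfolding is_N_def by blast
    with saturated_no_N X F show False by blast
  qed
qed

lemma cover_card_diff:
  assumes X: "X \<in> F" and Y: "Y \<in> F" and XY: "X \<subset> Y"
    and cover: "\<And>Z. Z \<in> F \<Longrightarrow> X \<subseteq> Z \<Longrightarrow> Z \<subseteq> Y \<Longrightarrow> Z = X \<or> Z = Y"
  shows "card (Y - X) \<le> card {Z \<in> F. Z \<subseteq> Y \<and> \<not> Z \<subseteq> X} + card {Z \<in> F. X \<subseteq> Z \<and> \<not> Y \<subseteq> Z}"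
    (is "_ \<le> card ?D + card ?E")
proof (cases "\<exists>x. Y - X = {x}")
  case True
  \<comment> \<open>With a one-point difference there is no set strictly between to add, but
    \<open>Y\<close> itself pays for the point.\<close>
  have "Y \<in> ?D" using Y XY by blast
  then have "card ?D > 0" using saturated_finite by (auto simp: card_gt_0_iff)
  with True show ?thesis by auto
next
  case False
  from cover_one_sided[OF X Y XY cover] show ?thesis
  proof
    assume D: "\<forall>Z\<in>F. Z \<subset> Y \<longrightarrow> Z \<subseteq> X"
    have "\<exists>Z\<in>F. x \<notin> Z \<and> Y - {x} \<subseteq> Z" if "x \<in> Y - X" for x
      using False that XY D by (intro cover_witness_above[OF X Y cover]) auto
    then obtain f where f: "\<And>x. x \<in> Y - X \<Longrightarrow> f x \<in> F \<and> x \<notin> f x \<and> Y - {x} \<subseteq> f x"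
      by metis
    have "inj_on f (Y - X)"
      by (rule inj_onI) (use f in blast)
    moreover have "f x \<in> ?E" if "x \<in> Y - X" for x
      using f[OF that] that XY by blast
    then have "f ` (Y - X) \<subseteq> ?E" by blast
    ultimately have "card (Y - X) \<le> card ?E"
      using saturated_finite by (intro card_inj_on_le) auto
    then show ?thesis by simp
  next
    assume E: "\<forall>Z\<in>F. X \<subset> Z \<longrightarrow> Y \<subseteq> Z"
    have "\<exists>Z\<in>F. x \<in> Z \<and> Z \<subseteq> insert x X" if "x \<in> Y - X" for x
      using False that XY E by (intro cover_witness_below[OF X Y cover]) auto
    then obtain f where f: "\<And>x. x \<in> Y - X \<Longrightarrow> f x \<in> F \<and> x \<in> f x \<and> f x \<subseteq> insert x X"
      by metis
    \<comment> \<open>\<open>x\<close> is the only element of \<open>f x\<close> outside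
      \<open>X\<close>.\<close>
    have "inj_on f (Y - X)"
      by (rule inj_onI) (use f in blast)
    moreover have "f x \<in> ?D" if "x \<in> Y - X" for x
      using f[OF that] that XY by blast
    then have "f ` (Y - X) \<subseteq> ?D" by blast
    ultimately have "card (Y - X) \<le> card ?D"
      using saturated_finite by (intro card_inj_on_le) auto
    then show ?thesis by simp
  qed
qed

section \<open>Summation along a chain\<close>

text \<open>Induction passes to a maximal member \<open>X\<close> properly below \<open>Y\<close>;
  from \<open>X\<close> to \<open>Y\<close> the two counts grow by exactly the two terms of
  \<open>cover_card_diff\<close>.\<close>

lemma card_member_le:
  assumes "Y \<in> F"
  shows "card Y \<le> card {Z \<in> F. Z \<subseteq> Y} + card {Z \<in> F. \<not> Y \<subseteq> Z}"
proof -
  have "finite Y" using saturated_subset[OF assms] finite_subset by blast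
  then show ?thesis
    using assms
  proof (induction Y rule: finite_psubset_induct)
    case (psubset Y)
    show ?case
    proof (cases "Y = {}")
      case False
      let ?P = "{Z \<in> F. Z \<subset> Y}"
      have "finite ?P" "?P \<noteq> {}"
        using saturated_finite saturated_empty False by auto
      then obtain X where X: "X \<in> ?P" and max: "\<And>Z. Z \<in> ?P \<Longrightarrow> X \<subseteq> Z \<Longrightarrow> X = Z"
        using finite_has_maximal[of ?P] by metis
      have cover: "Z = X \<or> Z = Y" if "Z \<in> F" "X \<subseteq> Z" "Z \<subseteq> Y" for Z
        using max[of Z] that by blast
      have "card {Z \<in> F. Z \<subseteq> Y} = card {Z \<in> F. Z \<subseteq> X} + card {Z \<in> F. Z \<subseteq> Y \<and> \<not> Z \<subseteq> X}"
        using X saturated_finite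
        by (subst card_Un_disjoint[symmetric]) (auto intro!: arg_cong[where f = card])
      moreover have "card {Z \<in> F. \<not> Y \<subseteq> Z} = card {Z \<in> F. \<not> X \<subseteq> Z} + card {Z \<in> F. X \<subseteq> Z \<and> \<not> Y \<subseteq> Z}"
        using X saturated_finite
        by (subst card_Un_disjoint[symmetric]) (auto intro!: arg_cong[where f = card])
      moreover have "card Y = card X + card (Y - X)"
        using X psubset.hyps
        by (metis (no_types, lifting) card_Diff_subset card_mono finite_subset le_add_diff_inverse
            mem_Collect_eq psubset_imp_subset)
      moreover have "card (Y - X)
          \<le> card {Z \<in> F. Z \<subseteq> Y \<and> \<not> Z \<subseteq> X} + card {Z \<in> F. X \<subseteq> Z \<and> \<not> Y \<subseteq> Z}"
        using X psubset.prems cover by (intro cover_card_diff) auto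
      moreover have "card X \<le> card {Z \<in> F. Z \<subseteq> X} + card {Z \<in> F. \<not> X \<subseteq> Z}"
        using X psubset.IH by blast
      ultimately show ?thesis by linarith
    qed simp
  qed
qed

lemma saturated_card_ge: "n \<le> 2 * card F"
proof -
  have "n \<le> card {Z \<in> F. Z \<subseteq> {1..n}} + card {Z \<in> F. \<not> {1..n} \<subseteq> Z}"
    using card_member_le[OF saturated_full] by simp
  also have "\<dots> \<le> card F + card F"
    using saturated_finite by (intro add_mono card_mono) auto
  finally show ?thesis by simp
qed

end

section \<open>The upper bound\<close>

text \<open>Singletons start at 2 because \<open>{1}\<close> is already a segment;
  \<open>k = 0\<close> gives the empty set.\<close>

definition segments_singletons :: "nat \<Rightarrow> nat set set" where
  "segments_singletons n = (\<lambda>k. {1..k}) ` {0..n} \<union> (\<lambda>k. {k}) ` {2..n}"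

lemma segment_in: "k \<le> n \<Longrightarrow> {1..k} \<in> segments_singletons n"
  unfolding segments_singletons_def by auto

lemma singleton_in: "1 \<le> k \<Longrightarrow> k \<le> n \<Longrightarrow> {k} \<in> segments_singletons n"
  using segment_in[of 1 n] unfolding segments_singletons_def by (cases "k = 1") auto

text \<open>\<open>B\<close> is nonempty and strictly below \<open>C\<close> and \<open>D\<close>,
  so neither of these is a singleton; both are segments, and segments form a chain.\<close>

lemma segments_singletons_free: "\<not> contains_induced_N (segments_singletons n)"
proof
  assume "contains_induced_N (segments_singletons n)"
  then obtain A B C D where F: "C \<in> segments_singletons n" "D \<in> segments_singletons n"
    and N: "is_N A B C D"
    unfolding contains_induced_N_iff by blast
  have "\<not> (\<exists>k. C = {k})" "\<not> (\<exists>k. D = {k})"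
    using N unfolding is_N_def by blast+
  then obtain k l where "C = {1..k}" "D = {1..l}"
    using F unfolding segments_singletons_def by auto
  then have "C \<subseteq> D \<or> D \<subseteq> C" by auto
  then show False using N unfolding is_N_def by blast
qed

text \<open>A new \<open>S\<close> always plays the role of \<open>C\<close>, and
  \<open>{Max S}\<close> that of \<open>A\<close>. \<open>D\<close> is a segment ending before
  \<open>Max S\<close> with a point outside \<open>S\<close>: a gap \<open>j\<close> of
  \<open>S\<close> if \<open>1 \<in> S\<close>, else the point 1.\<close>

lemma segments_singletons_saturated: "N_saturated n (segments_singletons n)"
  unfolding N_saturated_def
proof (intro conjI allI impI)
  show "segments_singletons n \<subseteq> Pow {1..n}"
    unfolding segments_singletons_def by auto
  show "\<not> contains_induced_N (segments_singletons n)"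
    by (rule segments_singletons_free)
  fix S assume "S \<subseteq> {1..n} \<and> S \<notin> segments_singletons n"
  then have S: "S \<subseteq> {1..n}" and notin: "S \<notin> segments_singletons n" by auto
  have fin: "finite S" using S finite_subset by blast
  have "S \<noteq> {}" using segment_in[of 0 n] notin by auto
  define k where "k = Max S"
  have k: "k \<in> S" and le_k: "\<And>i. i \<in> S \<Longrightarrow> i \<le> k"
    using fin \<open>S \<noteq> {}\<close> unfolding k_def by auto
  have kn: "1 \<le> k" "k \<le> n" using k S by auto
  show "contains_induced_N (insert S (segments_singletons n))"
  proof (cases "1 \<in> S")
    case True
    have "S \<noteq> {1..k}" using segment_in[OF kn(2)] notin by metis
    moreover have "S \<subseteq> {1..k}" using S le_k by auto
    ultimately obtain j where j: "j \<in> {1..k}" "j \<notin> S" by blast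
    have "j < k" "1 < j" using j k True by (auto simp: order_less_le)
    then have "is_N {k} {1} S {1..j}"
      using True k j unfolding is_N_def by (auto dest: subsetD[where c = j])
    moreover have "{k} \<in> segments_singletons n" "{1} \<in> segments_singletons n"
      "{1..j} \<in> segments_singletons n"
      using kn \<open>j < k\<close> singleton_in[of 1 n] singleton_in[of k n] segment_in[of j n] by auto
    ultimately show ?thesis
      unfolding contains_induced_N_iff by blast
  next
    case False
    have "S \<noteq> {k}" using singleton_in[OF kn] notin by metis
    then obtain i where i: "i \<in> S" "i \<noteq> k" using k by blast
    have ik: "i < k" "1 \<le> i" using le_k[OF i(1)] i S by auto
    then have "is_N {k} {i} S {1..i}"
      using False k i unfolding is_N_def by auto
    moreover have "{k} \<in> segments_singletons n" "{i} \<in> segments_singletons n"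
      "{1..i} \<in> segments_singletons n"
      using kn ik singleton_in[of i n] singleton_in[of k n] segment_in[of i n] by auto
    ultimately show ?thesis
      unfolding contains_induced_N_iff by blast
  qed
qed

lemma card_segments_singletons:
  assumes "n \<ge> 1"
  shows "card (segments_singletons n) \<le> 2 * n"
proof -
  have "card (segments_singletons n)
      \<le> card ((\<lambda>k. {1..k}) ` {0..n}) + card ((\<lambda>k. {k}) ` {2..n})"
    unfolding segments_singletons_def by (rule card_Un_le)
  also have "\<dots> \<le> card {0..n} + card {2..n}"
    by (intro add_mono card_image_le) auto
  finally show ?thesis using assms by simp
qed

theorem theorem4p3:
  shows "\<exists>c1 c2 :: real. c1 > 0 \<and> c2 > 0 \<and> (\<exists>n0. \<forall>n \<ge> n0.
           c1 * real n \<le> real (sat_star_N n) \<and> real (sat_star_N n) \<le> c2 * real n)"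
proof (intro exI conjI allI impI)
  show "(1/2 :: real) > 0" "(2 :: real) > 0" by simp_all
  \<comment> \<open>The threshold is 1: for \<open>n = 0\<close> the only saturated family is
    \<open>{{}}\<close>, which breaks the upper bound.\<close>
  fix n :: nat assume n: "1 \<le> n"
  \<comment> \<open>Existence makes the \<open>LEAST\<close> attained by a saturated family, to
    which the lower bound applies.\<close>
  have ex: "\<exists>F. N_saturated n F \<and> card F = card (segments_singletons n)"
    using segments_singletons_saturated by blast
  have "\<exists>F. N_saturated n F \<and> card F = sat_star_N n"
    unfolding sat_star_N_def by (rule LeastI) (rule ex)
  then have "n \<le> 2 * sat_star_N n"
    using saturated_card_ge by metis
  then show "1/2 * real n \<le> real (sat_star_N n)" by linarith
  have "sat_star_N n \<le> card (segments_singletons n)"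
    unfolding sat_star_N_def by (rule Least_le) (rule ex)
  then show "real (sat_star_N n) \<le> 2 * real n"
    using card_segments_singletons[OF n] by linarith
qed

end
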